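(* There is a faithful functor $\mathcal F_{\mathrm{OMon}}:\mathrm{OMon}\to \mathrm{Semir}^\dagger$, whose image is $\mathrm{Bipot}^\dagger$.
   Context: All monoids and semigroups are commutative. A semiring$^\dagger$ $(R,+,\cdot,1_R)$ is a set $R$ with two binary operations such that $(R,+)$ is an abelian semigroup (no zero element is required), $(R,\cdot,1_R)$ is a monoid with unit element $1_R$, and multiplication distributes over addition. A homomorphism of semirings$^\dagger$ is a homomorphism of multiplicative monoids (preserving the unit) that also preserves addition. $\mathrm{Semir}^\dagger$ is the category of semirings$^\dagger$ and their homomorphisms. A semiring$^\dagger$ $R$ is bipotent if $a+b\in\{a,b\}$ for all $a,b\in R$; $\mathrm{Bipot}^\dagger$ is the full subcategory of $\mathrm{Semir}^\dagger$ whose objects are the bipotent semirings$^\dagger$. An ordered monoid is a monoid $\mathcal M$ with a total order $\le$ such that $b\le c$ implies $ab\le ac$ for all $a,b,c\in\mathcal M$. $\mathrm{OMon}$ is the category of (totally) ordered monoids, whose morphisms are the monoid homomorphisms $\phi$ that are order-preserving, i.e. $a\le b$ implies $\phi(a)\le\phi(b)$. *)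

theory Defs
  imports "HOL-Algebra.Group"
begin

section \<open>Categories and functors\<close>

text \<open>\<open>Comp C g f\<close> is \<open>g\<close> after \<open>f\<close>. The
  operations are total functions of the logic; their values are relevant only on objects, arrows
  and composable pairs.\<close>

record ('o, 'm) cat =
  Obj :: "'o set"
  Arr :: "'m set"
  Dom :: "'m \<Rightarrow> 'o"
  Cod :: "'m \<Rightarrow> 'o"
  Ident :: "'o \<Rightarrow> 'm"
  Comp :: "'m \<Rightarrow> 'm \<Rightarrow> 'm"

locale category =
  fixes C :: "('o, 'm) cat"
  assumes dom_obj: "f \<in> Arr C \<Longrightarrow> Dom C f \<in> Obj C"
    and cod_obj: "f \<in> Arr C \<Longrightarrow> Cod C f \<in> Obj C"
    and ident_arr: "A \<in> Obj C \<Longrightarrow> Ident C A \<in> Arr C"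
    and dom_ident: "A \<in> Obj C \<Longrightarrow> Dom C (Ident C A) = A"
    and cod_ident: "A \<in> Obj C \<Longrightarrow> Cod C (Ident C A) = A"
    and comp_arr: "\<lbrakk>f \<in> Arr C; g \<in> Arr C; Cod C f = Dom C g\<rbrakk> \<Longrightarrow> Comp C g f \<in> Arr C"
    and dom_comp: "\<lbrakk>f \<in> Arr C; g \<in> Arr C; Cod C f = Dom C g\<rbrakk> \<Longrightarrow> Dom C (Comp C g f) = Dom C f"
    and cod_comp: "\<lbrakk>f \<in> Arr C; g \<in> Arr C; Cod C f = Dom C g\<rbrakk> \<Longrightarrow> Cod C (Comp C g f) = Cod C g"
    and comp_ident_right: "f \<in> Arr C \<Longrightarrow> Comp C f (Ident C (Dom C f)) = f"
    and comp_ident_left: "f \<in> Arr C \<Longrightarrow> Comp C (Ident C (Cod C f)) f = f"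
    and comp_assoc: "\<lbrakk>f \<in> Arr C; g \<in> Arr C; h \<in> Arr C; Cod C f = Dom C g; Cod C g = Dom C h\<rbrakk>
      \<Longrightarrow> Comp C h (Comp C g f) = Comp C (Comp C h g) f"

record ('o, 'm, 'p, 'n) functor_maps =
  on_obj :: "'o \<Rightarrow> 'p"
  on_arr :: "'m \<Rightarrow> 'n"

locale cat_functor = source: category C + target: category D
  for C :: "('o, 'm) cat" and D :: "('p, 'n) cat" +
  fixes F :: "('o, 'm, 'p, 'n) functor_maps"
  assumes on_obj_closed: "A \<in> Obj C \<Longrightarrow> on_obj F A \<in> Obj D"
    and on_arr_closed: "f \<in> Arr C \<Longrightarrow> on_arr F f \<in> Arr D"
    and on_arr_dom: "f \<in> Arr C \<Longrightarrow> Dom D (on_arr F f) = on_obj F (Dom C f)"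
    and on_arr_cod: "f \<in> Arr C \<Longrightarrow> Cod D (on_arr F f) = on_obj F (Cod C f)"
    and on_arr_ident: "A \<in> Obj C \<Longrightarrow> on_arr F (Ident C A) = Ident D (on_obj F A)"
    and on_arr_comp: "\<lbrakk>f \<in> Arr C; g \<in> Arr C; Cod C f = Dom C g\<rbrakk>
      \<Longrightarrow> on_arr F (Comp C g f) = Comp D (on_arr F g) (on_arr F f)"

locale faithful_functor = cat_functor +
  assumes faithful: "\<lbrakk>f \<in> Arr C; g \<in> Arr C; Dom C f = Dom C g; Cod C f = Cod C g;
      on_arr F f = on_arr F g\<rbrakk> \<Longrightarrow> f = g"

definition full_subcategory :: "('o, 'm) cat \<Rightarrow> 'o set \<Rightarrow> ('o, 'm) cat" where
  "full_subcategory C S = C\<lparr>Obj := Obj C \<inter> S,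
     Arr := {f \<in> Arr C. Dom C f \<in> Obj C \<inter> S \<and> Cod C f \<in> Obj C \<inter> S}\<rparr>"

text \<open>The image consists of the objects \<open>F A\<close> and the arrows \<open>F f\<close> themselves (strict, not closed
  under isomorphism), with the structure maps inherited from \<open>D\<close>.\<close>

definition functor_image ::
    "('o, 'm) cat \<Rightarrow> ('p, 'n) cat \<Rightarrow> ('o, 'm, 'p, 'n) functor_maps \<Rightarrow> ('p, 'n) cat" where
  "functor_image C D F = D\<lparr>Obj := on_obj F ` Obj C, Arr := on_arr F ` Arr C\<rparr>"


section \<open>Categories of structured sets\<close>

text \<open>An arrow records its source and target, so that hom-sets are disjoint.\<close>

datatype ('o, 'a) arrow = Arrow (src: 'o) (fn: "'a \<Rightarrow> 'a") (tgt: 'o)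

definition concrete_cat ::
    "'o set \<Rightarrow> ('o \<Rightarrow> 'a set) \<Rightarrow> ('o \<Rightarrow> 'o \<Rightarrow> ('a \<Rightarrow> 'a) set) \<Rightarrow> ('o, ('o, 'a) arrow) cat" where
  "concrete_cat Obs U Hom = \<lparr>
     Obj = Obs,
     Arr = {Arrow A f B | A f B. A \<in> Obs \<and> B \<in> Obs \<and> f \<in> Hom A B},
     Dom = src,
     Cod = tgt,
     Ident = (\<lambda>A. Arrow A (\<lambda>x\<in>U A. x) A),
     Comp = (\<lambda>g f. Arrow (src f) (compose (U (src f)) (fn g) (fn f)) (tgt g))\<rparr>"


section \<open>Ordered monoids and semirings without zero\<close>

text \<open>Operations and homomorphisms are extensional (\<open>\<rightarrow>\<^sub>E\<close>), i.e. \<open>undefined\<close> outside the carrier, and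
  the order is a relation contained in the square of the carrier. Hence equality in the logic of two
  structures, or of two homomorphisms, is equality in the set-theoretic sense.\<close>

record 'a omon = "'a monoid" +
  ord_rel :: "('a \<times> 'a) set"

locale ordered_monoid = comm_monoid M for M :: "'a omon" (structure) +
  assumes mult_ext: "mult M \<in> carrier M \<rightarrow>\<^sub>E carrier M \<rightarrow>\<^sub>E carrier M"
    and linear_order: "linear_order_on (carrier M) (ord_rel M)"
    and mult_mono: "\<lbrakk>a \<in> carrier M; b \<in> carrier M; c \<in> carrier M; (b, c) \<in> ord_rel M\<rbrakk>
      \<Longrightarrow> (a \<otimes> b, a \<otimes> c) \<in> ord_rel M"

definition omon_hom :: "'a omon \<Rightarrow> 'a omon \<Rightarrow> ('a \<Rightarrow> 'a) set" where
  "omon_hom M N = {\<phi> \<in> hom M N. \<phi> \<in> carrier M \<rightarrow>\<^sub>E carrier N \<and> \<phi> \<one>\<^bsub>M\<^esub> = \<one>\<^bsub>N\<^esub> \<and>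
     (\<forall>a\<in>carrier M. \<forall>b\<in>carrier M. (a, b) \<in> ord_rel M \<longrightarrow> (\<phi> a, \<phi> b) \<in> ord_rel N)}"

definition OMon :: "('a omon, ('a omon, 'a) arrow) cat" where
  "OMon = concrete_cat {M. ordered_monoid M} carrier omon_hom"

text \<open>The library's \<open>ring\<close> record is not used because it carries a zero.\<close>

record 'a semir = "'a monoid" +
  plus :: "'a \<Rightarrow> 'a \<Rightarrow> 'a" (infixl \<open>\<oplus>\<index>\<close> 65)

locale semiring_dagger = comm_monoid R for R :: "'a semir" (structure) +
  assumes mult_ext: "mult R \<in> carrier R \<rightarrow>\<^sub>E carrier R \<rightarrow>\<^sub>E carrier R"
    and plus_ext: "plus R \<in> carrier R \<rightarrow>\<^sub>E carrier R \<rightarrow>\<^sub>E carrier R"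
    and plus_assoc: "\<lbrakk>a \<in> carrier R; b \<in> carrier R; c \<in> carrier R\<rbrakk>
      \<Longrightarrow> (a \<oplus> b) \<oplus> c = a \<oplus> (b \<oplus> c)"
    and plus_comm: "\<lbrakk>a \<in> carrier R; b \<in> carrier R\<rbrakk> \<Longrightarrow> a \<oplus> b = b \<oplus> a"
    and distrib: "\<lbrakk>a \<in> carrier R; b \<in> carrier R; c \<in> carrier R\<rbrakk>
      \<Longrightarrow> a \<otimes> (b \<oplus> c) = (a \<otimes> b) \<oplus> (a \<otimes> c)"

definition semir_hom :: "'a semir \<Rightarrow> 'a semir \<Rightarrow> ('a \<Rightarrow> 'a) set" where
  "semir_hom R S = {\<phi> \<in> hom R S. \<phi> \<in> carrier R \<rightarrow>\<^sub>E carrier S \<and> \<phi> \<one>\<^bsub>R\<^esub> = \<one>\<^bsub>S\<^esub> \<and>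
     (\<forall>a\<in>carrier R. \<forall>b\<in>carrier R. \<phi> (a \<oplus>\<^bsub>R\<^esub> b) = \<phi> a \<oplus>\<^bsub>S\<^esub> \<phi> b)}"

definition Semir_dagger :: "('a semir, ('a semir, 'a) arrow) cat" where
  "Semir_dagger = concrete_cat {R. semiring_dagger R} carrier semir_hom"

definition bipotent :: "'a semir \<Rightarrow> bool" where
  "bipotent R \<longleftrightarrow> (\<forall>a\<in>carrier R. \<forall>b\<in>carrier R. a \<oplus>\<^bsub>R\<^esub> b \<in> {a, b})"

definition Bipot_dagger :: "('a semir, ('a semir, 'a) arrow) cat" where
  "Bipot_dagger = full_subcategory Semir_dagger {R. bipotent R}"

end

theory Submission
  imports Defs
begin

text \<open>A total order and a bipotent addition are the same data, via \<open>a + b = max a b\<close> and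
  \<open>a \<le> b \<longleftrightarrow> a + b = b\<close>, and under this dictionary translation-invariance of the order is
  distributivity. A monoid homomorphism preserves the order iff it preserves maxima, so the functor
  leaves the underlying maps unchanged and is bijective onto the bipotent semirings.\<close>

section \<open>Categories of structured sets\<close>

lemma concrete_cat_sel [simp]:
  "Obj (concrete_cat Obs U Hom) = Obs"
  "Dom (concrete_cat Obs U Hom) = src"
  "Cod (concrete_cat Obs U Hom) = tgt"
  "Ident (concrete_cat Obs U Hom) A = Arrow A (\<lambda>x\<in>U A. x) A"
  "Comp (concrete_cat Obs U Hom) g f = Arrow (src f) (compose (U (src f)) (fn g) (fn f)) (tgt g)"
  by (simp_all add: concrete_cat_def)

lemma Arr_concrete_cat [simp]:
  "f \<in> Arr (concrete_cat Obs U Hom) \<longleftrightarrow>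
    src f \<in> Obs \<and> tgt f \<in> Obs \<and> fn f \<in> Hom (src f) (tgt f)"
  by (cases f) (auto simp: concrete_cat_def)

text \<open>The unit laws are equations between total functions: composing with the restricted
  identity changes nothing on \<open>U A\<close>, and outside it both sides are
  \<open>undefined\<close> because homs lie in \<open>\<rightarrow>\<^sub>E\<close>.\<close>

lemma category_concrete_cat:
  assumes hom_funcset: "\<And>A B. Hom A B \<subseteq> U A \<rightarrow>\<^sub>E U B"
    and ident: "\<And>A. A \<in> Obs \<Longrightarrow> (\<lambda>x\<in>U A. x) \<in> Hom A A"
    and comp: "\<And>A B C f g. \<lbrakk>A \<in> Obs; B \<in> Obs; C \<in> Obs; f \<in> Hom A B; g \<in> Hom B C\<rbrakk>
      \<Longrightarrow> compose (U A) g f \<in> Hom A C"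
  shows "category (concrete_cat Obs U Hom)"
proof
  fix f g h
  assume f: "f \<in> Arr (concrete_cat Obs U Hom)" and g: "g \<in> Arr (concrete_cat Obs U Hom)"
    and h: "h \<in> Arr (concrete_cat Obs U Hom)"
    and "Cod (concrete_cat Obs U Hom) f = Dom (concrete_cat Obs U Hom) g"
      "Cod (concrete_cat Obs U Hom) g = Dom (concrete_cat Obs U Hom) h"
  moreover from f have "fn f \<in> U (src f) \<rightarrow>\<^sub>E U (tgt f)"
    using hom_funcset by auto
  ultimately show "Comp (concrete_cat Obs U Hom) h (Comp (concrete_cat Obs U Hom) g f) =
      Comp (concrete_cat Obs U Hom) (Comp (concrete_cat Obs U Hom) h g) f"
    by (auto simp: PiE_iff intro!: compose_assoc)
next
  fix f assume "f \<in> Arr (concrete_cat Obs U Hom)"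
  then have "fn f \<in> U (src f) \<rightarrow>\<^sub>E U (tgt f)"
    using hom_funcset by auto
  then show "Comp (concrete_cat Obs U Hom) f
        (Ident (concrete_cat Obs U Hom) (Dom (concrete_cat Obs U Hom) f)) = f"
    and "Comp (concrete_cat Obs U Hom)
        (Ident (concrete_cat Obs U Hom) (Cod (concrete_cat Obs U Hom) f)) f = f"
    by (cases f; auto simp: compose_def fun_eq_iff PiE_iff extensional_def)+
qed (auto intro: ident comp)

lemma category_OMon: "category OMon"
  unfolding OMon_def
  by (rule category_concrete_cat)
    (auto simp: omon_hom_def hom_def compose_def PiE_iff Pi_iff
      monoid.m_closed monoid.one_closed ordered_monoid_def comm_monoid_def intro: extensional_arb)

lemma category_Semir_dagger: "category Semir_dagger"
proof -
  have ident: "(\<lambda>x\<in>carrier R. x) \<in> semir_hom R R" if "semiring_dagger R" for R :: "'a semir"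
  proof -
    interpret semiring_dagger R by fact
    show ?thesis
      \<comment> \<open>Closure under addition puts the sum in the carrier, where the restricted
        identity fixes it.\<close>
      using plus_ext by (auto simp: semir_hom_def hom_def PiE_iff)
  qed
  have comp: "compose (carrier R) g f \<in> semir_hom R T"
    if "semiring_dagger R" "f \<in> semir_hom R S" "g \<in> semir_hom S T" for R S T :: "'a semir" and f g
  proof -
    interpret semiring_dagger R by fact
    show ?thesis
      using that plus_ext by (auto simp: semir_hom_def hom_def compose_def PiE_iff Pi_iff)
  qed
  show ?thesis
    unfolding Semir_dagger_def
  proof (rule category_concrete_cat)
    show "semir_hom R S \<subseteq> carrier R \<rightarrow>\<^sub>E carrier S" for R S :: "'a semir"
      by (auto simp: semir_hom_def)
    show "(\<lambda>x\<in>carrier A. x) \<in> semir_hom A A" if "A \<in> {R. semiring_dagger R}" for A :: "'a semir"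
      using that ident by simp
    show "compose (carrier A) g f \<in> semir_hom A C"
      if "A \<in> {R. semiring_dagger R}" "f \<in> semir_hom A B" "g \<in> semir_hom B C"
      for A B C :: "'a semir" and f g
      using that comp by simp
  qed
qed

section \<open>From ordered monoids to bipotent semirings\<close>

definition semir_of_omon :: "'a omon \<Rightarrow> 'a semir" where
  "semir_of_omon M = \<lparr>carrier = carrier M, mult = mult M, one = one M,
     plus = (\<lambda>a\<in>carrier M. \<lambda>b\<in>carrier M. if (a, b) \<in> ord_rel M then b else a)\<rparr>"

lemma semir_of_omon_sel [simp]:
  "carrier (semir_of_omon M) = carrier M"
  "mult (semir_of_omon M) = mult M"
  "one (semir_of_omon M) = one M"
  "plus (semir_of_omon M) = (\<lambda>a\<in>carrier M. \<lambda>b\<in>carrier M. if (a, b) \<in> ord_rel M then b else a)"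
  by (simp_all add: semir_of_omon_def)

lemma bipotent_semir_of_omon: "bipotent (semir_of_omon M)"
  by (simp add: bipotent_def)

context ordered_monoid
begin

lemma ord_refl: "a \<in> carrier M \<Longrightarrow> (a, a) \<in> ord_rel M"
  using linear_order by (auto simp: order_on_defs refl_on_def)

lemma ord_antisym: "\<lbrakk>(a, b) \<in> ord_rel M; (b, a) \<in> ord_rel M\<rbrakk> \<Longrightarrow> a = b"
  using linear_order by (auto simp: order_on_defs antisym_def)

lemma ord_trans: "\<lbrakk>(a, b) \<in> ord_rel M; (b, c) \<in> ord_rel M\<rbrakk> \<Longrightarrow> (a, c) \<in> ord_rel M"
  using linear_order by (auto simp: order_on_defs dest: transD)

lemma ord_total: "\<lbrakk>a \<in> carrier M; b \<in> carrier M; (a, b) \<notin> ord_rel M\<rbrakk> \<Longrightarrow> (b, a) \<in> ord_rel M"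
  using linear_order ord_refl[of a] by (auto simp: order_on_defs total_on_def)

lemma semiring_dagger_semir_of_omon: "semiring_dagger (semir_of_omon M)"
proof (intro semiring_dagger.intro semiring_dagger_axioms.intro)
  show "comm_monoid (semir_of_omon M)"
    by (rule comm_monoidI) (simp_all add: m_ac)
next
  fix a b c
  assume "a \<in> carrier (semir_of_omon M)" "b \<in> carrier (semir_of_omon M)"
    "c \<in> carrier (semir_of_omon M)"
  then have abc: "a \<in> carrier M" "b \<in> carrier M" "c \<in> carrier M"
    by simp_all
  show "a \<oplus>\<^bsub>semir_of_omon M\<^esub> b \<oplus>\<^bsub>semir_of_omon M\<^esub> c =
      a \<oplus>\<^bsub>semir_of_omon M\<^esub> (b \<oplus>\<^bsub>semir_of_omon M\<^esub> c)"
  \<comment> \<open>In the two mixed cases both sides reduce to the same term. Only when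
    \<open>a\<close>, \<open>b\<close>, \<open>c\<close> are monotonically arranged must
    \<open>a\<close> be compared with \<open>c\<close>, by transitivity.\<close>
  proof (cases "(a, b) \<in> ord_rel M"; cases "(b, c) \<in> ord_rel M")
    assume "(a, b) \<in> ord_rel M" "(b, c) \<in> ord_rel M"
    moreover from this have "(a, c) \<in> ord_rel M"
      by (rule ord_trans)
    ultimately show ?thesis
      using abc by simp
  next
    assume not_le: "(a, b) \<notin> ord_rel M" "(b, c) \<notin> ord_rel M"
    with abc have "(c, a) \<in> ord_rel M"
      by (meson ord_total ord_trans)
    with not_le abc show ?thesis
      by (cases "(a, c) \<in> ord_rel M") (auto dest: ord_antisym)
  qed (use abc in simp_all)
  show "a \<otimes>\<^bsub>semir_of_omon M\<^esub> (b \<oplus>\<^bsub>semir_of_omon M\<^esub> c) =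
      (a \<otimes>\<^bsub>semir_of_omon M\<^esub> b) \<oplus>\<^bsub>semir_of_omon M\<^esub> (a \<otimes>\<^bsub>semir_of_omon M\<^esub> c)"
    \<comment> \<open>Multiplication by \<open>a\<close> is monotone, so it commutes with maxima. It
      may identify distinct elements; then both comparisons of the products hold and antisymmetry
      makes them equal.\<close>
    using abc mult_mono[of a b c] mult_mono[of a c b] ord_total[of b c] by (auto intro: ord_antisym)
next
  fix a b
  assume "a \<in> carrier (semir_of_omon M)" "b \<in> carrier (semir_of_omon M)"
  then show "a \<oplus>\<^bsub>semir_of_omon M\<^esub> b = b \<oplus>\<^bsub>semir_of_omon M\<^esub> a"
    using ord_total[of a b] by (auto intro: ord_antisym)
next
  show "mult (semir_of_omon M) \<in> carrier (semir_of_omon M) \<rightarrow>\<^sub>E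
      carrier (semir_of_omon M) \<rightarrow>\<^sub>E carrier (semir_of_omon M)"
    using mult_ext by simp
  show "plus (semir_of_omon M) \<in> carrier (semir_of_omon M) \<rightarrow>\<^sub>E
      carrier (semir_of_omon M) \<rightarrow>\<^sub>E carrier (semir_of_omon M)"
    by (simp add: PiE_iff)
qed

end

text \<open>Monotone maps between chains are exactly those preserving binary maxima. An equality of
  hom-sets gives at once that the functor is well defined on arrows and that it is full.\<close>

lemma semir_hom_semir_of_omon:
  assumes "ordered_monoid M" "ordered_monoid N"
  shows "semir_hom (semir_of_omon M) (semir_of_omon N) = omon_hom M N"
proof -
  interpret M: ordered_monoid M by fact
  interpret N: ordered_monoid N by fact
  have mono_iff: "(\<forall>a\<in>carrier M. \<forall>b\<in>carrier M. (a, b) \<in> ord_rel M \<longrightarrow> (\<phi> a, \<phi> b) \<in> ord_rel N) \<longleftrightarrow>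
      (\<forall>a\<in>carrier M. \<forall>b\<in>carrier M.
        \<phi> (a \<oplus>\<^bsub>semir_of_omon M\<^esub> b) = \<phi> a \<oplus>\<^bsub>semir_of_omon N\<^esub> \<phi> b)" (is "?mono \<longleftrightarrow> ?additive")
    if \<phi>: "\<phi> \<in> carrier M \<rightarrow>\<^sub>E carrier N" for \<phi>
  proof
    assume mono: ?mono
    show ?additive
    proof (intro ballI)
      fix a b assume ab: "a \<in> carrier M" "b \<in> carrier M"
      with \<phi> have \<phi>_ab: "\<phi> a \<in> carrier N" "\<phi> b \<in> carrier N"
        by auto
      show "\<phi> (a \<oplus>\<^bsub>semir_of_omon M\<^esub> b) = \<phi> a \<oplus>\<^bsub>semir_of_omon N\<^esub> \<phi> b"
      proof (cases "(a, b) \<in> ord_rel M")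
        case True
        with mono ab \<phi>_ab show ?thesis
          by simp
      next
        case False
        with mono ab have "(\<phi> b, \<phi> a) \<in> ord_rel N"
          by (simp add: M.ord_total)
        \<comment> \<open>Here the maximum of \<open>a\<close> and \<open>b\<close> is
          \<open>a\<close>. If \<open>\<phi> a \<le> \<phi> b\<close> holds too, the sum of the
          images is \<open>\<phi> b\<close>, which antisymmetry identifies with
          \<open>\<phi> a\<close>.\<close>
        with False ab \<phi>_ab show ?thesis
          by (auto intro: N.ord_antisym)
      qed
    qed
  next
    assume additive: ?additive
    show ?mono
    proof (intro ballI impI)
      fix a b assume "a \<in> carrier M" "b \<in> carrier M" "(a, b) \<in> ord_rel M"
      moreover from this \<phi> have "\<phi> a \<in> carrier N" "\<phi> b \<in> carrier N"
        by auto
      ultimately show "(\<phi> a, \<phi> b) \<in> ord_rel N"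
        \<comment> \<open>Additivity says that the maximum of \<open>\<phi> a\<close> and
          \<open>\<phi> b\<close> is \<open>\<phi> b\<close>: either the claim holds, or the
          \<open>if\<close> returns \<open>\<phi> a = \<phi> b\<close> and reflexivity
          applies.\<close>
        using additive[THEN bspec, THEN bspec, of a b] N.ord_refl[of "\<phi> b"]
        by (simp split: if_splits)
    qed
  qed
  show ?thesis
    unfolding semir_hom_def omon_hom_def
    \<comment> \<open>The congruence rule supplies the function-space hypothesis of
      \<open>mono_iff\<close>; addition stays folded so that the equivalence matches.\<close>
    by (intro Collect_cong) (simp add: mono_iff hom_def del: semir_of_omon_sel(4) cong: conj_cong)
qed

section \<open>From bipotent semirings to ordered monoids\<close>

definition omon_of_semir :: "'a semir \<Rightarrow> 'a omon" where
  "omon_of_semir R = \<lparr>carrier = carrier R, mult = mult R, one = one R,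
     ord_rel = {(a, b). a \<in> carrier R \<and> b \<in> carrier R \<and> a \<oplus>\<^bsub>R\<^esub> b = b}\<rparr>"

lemma omon_of_semir_sel [simp]:
  "carrier (omon_of_semir R) = carrier R"
  "mult (omon_of_semir R) = mult R"
  "one (omon_of_semir R) = one R"
  "(a, b) \<in> ord_rel (omon_of_semir R) \<longleftrightarrow> a \<in> carrier R \<and> b \<in> carrier R \<and> a \<oplus>\<^bsub>R\<^esub> b = b"
  by (simp_all add: omon_of_semir_def)

context semiring_dagger
begin

text \<open>Transitivity comes from associativity, antisymmetry from commutativity, reflexivity from
  bipotence at equal arguments, and totality from bipotence with commutativity. Monotonicity is
  distributivity: \<open>b + c = c\<close> gives \<open>ab + ac = a(b + c) = ac\<close>.\<close>

lemma ordered_monoid_omon_of_semir: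
  assumes "bipotent R"
  shows "ordered_monoid (omon_of_semir R)"
proof (intro ordered_monoid.intro ordered_monoid_axioms.intro)
  show "comm_monoid (omon_of_semir R)"
    by (rule comm_monoidI) (simp_all add: m_ac)
next
  have bip: "a \<oplus> b = a \<or> a \<oplus> b = b" if "a \<in> carrier R" "b \<in> carrier R" for a b
    using assms that by (auto simp: bipotent_def)
  have "trans (ord_rel (omon_of_semir R))"
    using plus_assoc by (intro transI) (simp, metis)
  moreover have "antisym (ord_rel (omon_of_semir R))"
    by (auto simp: antisym_def) (metis plus_comm)
  moreover have "refl_on (carrier R) (ord_rel (omon_of_semir R))"
    by (auto simp: refl_on_def) (metis bip)
  moreover have "total_on (carrier R) (ord_rel (omon_of_semir R))"
    using bip plus_comm by (auto simp: total_on_def)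
  moreover have "ord_rel (omon_of_semir R) \<subseteq> carrier R \<times> carrier R"
    by auto
  ultimately show "linear_order_on (carrier (omon_of_semir R)) (ord_rel (omon_of_semir R))"
    by (simp add: order_on_defs)
next
  show "mult (omon_of_semir R) \<in> carrier (omon_of_semir R) \<rightarrow>\<^sub>E
      carrier (omon_of_semir R) \<rightarrow>\<^sub>E carrier (omon_of_semir R)"
    using mult_ext by simp
qed (simp add: distrib[symmetric])

text \<open>This makes the functor surjective onto bipotent objects on the nose, as the strict image
  requires. On the carrier, if \<open>a + b\<close> is not \<open>b\<close>, bipotence leaves only
  \<open>a\<close>.\<close>

lemma semir_of_omon_of_semir:
  assumes "bipotent R"
  shows "semir_of_omon (omon_of_semir R) = R"
proof -
  have "plus (semir_of_omon (omon_of_semir R)) a b = a \<oplus> b" for a b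
  proof (cases "a \<in> carrier R \<and> b \<in> carrier R")
    case True
    with assms have "a \<oplus> b = a \<or> a \<oplus> b = b"
      by (auto simp: bipotent_def)
    with True show ?thesis
      by auto
  next
    case False
    \<comment> \<open>Both additions are extensional in each argument, so off the carrier they share
      the default value \<open>undefined\<close>.\<close>
    with plus_ext show ?thesis
      by (auto simp: PiE_iff extensional_def restrict_def)
  qed
  then show ?thesis
    by (intro semir.equality) (auto simp del: semir_of_omon_sel(4))
qed

end

section \<open>The functor, its faithfulness and its image\<close>

definition F_OMon :: "('a omon, ('a omon, 'a) arrow, 'a semir, ('a semir, 'a) arrow) functor_maps" where
  "F_OMon = \<lparr>on_obj = semir_of_omon,
     on_arr = (\<lambda>f. Arrow (semir_of_omon (src f)) (fn f) (semir_of_omon (tgt f)))\<rparr>"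

lemma F_OMon_sel [simp]:
  "on_obj F_OMon = semir_of_omon"
  "on_arr F_OMon f = Arrow (semir_of_omon (src f)) (fn f) (semir_of_omon (tgt f))"
  by (simp_all add: F_OMon_def)

lemma faithful_functor_F_OMon: "faithful_functor OMon Semir_dagger F_OMon"
proof (intro faithful_functor.intro cat_functor.intro cat_functor_axioms.intro
    faithful_functor_axioms.intro category_OMon category_Semir_dagger)
qed (auto simp: OMon_def Semir_dagger_def semir_hom_semir_of_omon arrow.expand
    ordered_monoid.semiring_dagger_semir_of_omon)

text \<open>Both sides inherit their structure maps from \<open>Semir_dagger\<close>, so only
  objects and arrows are compared. Surjectivity on objects settles the former, fullness the
  latter.\<close>

lemma functor_image_F_OMon: "functor_image OMon Semir_dagger F_OMon = Bipot_dagger"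
proof -
  have obj: "on_obj F_OMon ` Obj OMon = Obj Semir_dagger \<inter> {R. bipotent R}"
  proof (intro equalityI subsetI)
    fix R assume "R \<in> Obj Semir_dagger \<inter> {R. bipotent R}"
    then have "R = semir_of_omon (omon_of_semir R)" "ordered_monoid (omon_of_semir R)"
      by (auto simp: Semir_dagger_def semiring_dagger.semir_of_omon_of_semir
          semiring_dagger.ordered_monoid_omon_of_semir)
    then show "R \<in> on_obj F_OMon ` Obj OMon"
      by (simp add: OMon_def image_iff) metis
  qed (auto simp: OMon_def Semir_dagger_def bipotent_semir_of_omon
      ordered_monoid.semiring_dagger_semir_of_omon)
  have arr: "on_arr F_OMon ` Arr OMon = {f \<in> Arr Semir_dagger.
      Dom Semir_dagger f \<in> on_obj F_OMon ` Obj OMon \<and>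
      Cod Semir_dagger f \<in> on_obj F_OMon ` Obj OMon}"
  proof (intro equalityI subsetI)
    fix f assume f: "f \<in> {f \<in> Arr Semir_dagger.
      Dom Semir_dagger f \<in> on_obj F_OMon ` Obj OMon \<and>
      Cod Semir_dagger f \<in> on_obj F_OMon ` Obj OMon}"
    then obtain M N where "ordered_monoid M" "ordered_monoid N"
      "src f = semir_of_omon M" "tgt f = semir_of_omon N"
      by (auto simp: OMon_def Semir_dagger_def)
    \<comment> \<open>The equality of hom-sets lets the same underlying map serve as the preimage of
      \<open>f\<close>.\<close>
    moreover from this f have "Arrow M (fn f) N \<in> Arr OMon"
      by (simp add: OMon_def Semir_dagger_def semir_hom_semir_of_omon)
    ultimately show "f \<in> on_arr F_OMon ` Arr OMon"
      by (intro image_eqI[of _ _ "Arrow M (fn f) N"]) (auto simp: arrow.expand)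
  qed (auto simp: OMon_def Semir_dagger_def semir_hom_semir_of_omon
      ordered_monoid.semiring_dagger_semir_of_omon)
  show ?thesis
    by (simp only: functor_image_def Bipot_dagger_def full_subcategory_def obj[symmetric] arr)
qed

theorem proposition3p11:
  shows "\<exists>F :: ('a omon, ('a omon, 'a) arrow, 'a semir, ('a semir, 'a) arrow) functor_maps.
    faithful_functor OMon Semir_dagger F \<and>
    functor_image OMon Semir_dagger F = Bipot_dagger"
  using faithful_functor_F_OMon functor_image_F_OMon by blast

end
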